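(* Let $q\ge5$ be prime, $q^*=(-1)^{(q-1)/2}q$ and $u_q(j)=(3^j-q^*(-1)^j)/4$ ($j\ge1$). Let $d>1$ and write $d=3^{\alpha}\delta$ with $\gcd(\delta,3)=1$. Then the sequence $(u_q(j))_{j\ge1}$ is eventually periodic modulo $d$, its period $\rho_q(d)$ satisfies $$\rho_q(d)=\begin{cases}\operatorname{ord}_{4\delta}(9) & \text{if } d=q \text{ and } \operatorname{ord}_q(3) \text{ is odd};\\ 2\operatorname{ord}_{4\delta}(9) & \text{otherwise},\end{cases}$$ and its pre-period equals $\max(1,\alpha)$.
   Context: A sequence $(v_j)$ is (eventually) periodic modulo $d$ if there are $n_0\ge1$, $k\ge1$ with $v_n\equiv v_{n+k}\pmod d$ for all $n\ge n_0$; the smallest such $k$ (valid for all $n\ge n_0$ for some $n_0$) is the period, and the minimal admissible $n_0$ is the pre-period. $\operatorname{ord}_m(a)$ denotes the multiplicative order of $a$ modulo $m$. *)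

theory Defs
  imports "HOL-Number_Theory.Number_Theory"
begin

definition qstar :: "nat \<Rightarrow> int" where
  "qstar q = (- 1) ^ ((q - 1) div 2) * int q"

text \<open>
  For odd \<open>q\<close> the integer division below is exact (lemma \<open>u_exact\<close>),
  because \<open>qstar q \<equiv> 1 (mod 4)\<close>.
\<close>

definition u :: "nat \<Rightarrow> nat \<Rightarrow> int" where
  "u q j = (3 ^ j - qstar q * (- 1) ^ j) div 4"

text \<open>
  Sequences are indexed by \<open>j \<ge> 1\<close>: as \<open>n0 \<ge> 1\<close> is required, the value of \<open>v\<close> at
  \<open>0\<close> is irrelevant in all of the following notions.
\<close>

definition periodic_mod_from :: "int \<Rightarrow> (nat \<Rightarrow> int) \<Rightarrow> nat \<Rightarrow> nat \<Rightarrow> bool" where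
  "periodic_mod_from d v n0 k \<longleftrightarrow>
     n0 \<ge> 1 \<and> k \<ge> 1 \<and> (\<forall>n\<ge>n0. [v n = v (n + k)] (mod d))"

definition eventually_periodic_mod :: "int \<Rightarrow> (nat \<Rightarrow> int) \<Rightarrow> bool" where
  "eventually_periodic_mod d v \<longleftrightarrow> (\<exists>n0 k. periodic_mod_from d v n0 k)"

text \<open>The next two are meaningful only for eventually periodic sequences.\<close>

definition period_mod :: "int \<Rightarrow> (nat \<Rightarrow> int) \<Rightarrow> nat" where
  "period_mod d v = (LEAST k. \<exists>n0. periodic_mod_from d v n0 k)"

definition preperiod_mod :: "int \<Rightarrow> (nat \<Rightarrow> int) \<Rightarrow> nat" where
  "preperiod_mod d v = (LEAST n0. \<exists>k. periodic_mod_from d v n0 k)"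

lemma u_exact:
  assumes "odd q"
  shows "real_of_int (u q j) = (3 ^ j - real_of_int (qstar q) * (- 1) ^ j) / 4"
proof -
  obtain m where m: "q = 2 * m + 1"
    using assms by (elim oddE)
  have 1: "[qstar q = 1] (mod 4)"
  proof (cases "even m")
    case True
    then obtain l where "m = 2 * l" by (elim evenE)
    then show ?thesis by (simp add: m qstar_def cong_iff_dvd_diff)
  next
    case False
    then obtain l where "m = 2 * l + 1" by (elim oddE)
    then have "qstar q - 1 = 4 * (- int l - 1)"
      by (simp add: m qstar_def)
    then have "4 dvd qstar q - 1" by (rule dvdI)
    then show ?thesis unfolding cong_iff_dvd_diff .
  qed
  have "[(3::int) ^ j = (- 1) ^ j] (mod 4)"
    by (intro cong_pow) (simp add: cong_iff_dvd_diff)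
  moreover have "[qstar q * (- 1) ^ j = 1 * (- 1) ^ j] (mod 4)"
    by (intro cong_mult 1) simp
  ultimately have "[3 ^ j = qstar q * (- 1) ^ j] (mod 4)"
    by (metis cong_sym cong_trans mult_1)
  then have "4 dvd 3 ^ j - qstar q * (- 1) ^ j"
    by (simp add: cong_iff_dvd_diff)
  then show ?thesis
    by (simp add: u_def real_of_int_div)
qed

text \<open>An index admissible for some \<open>k\<close> is admissible for the period itself.\<close>

lemma periodic_mod_from_period_mod:
  assumes "periodic_mod_from d v n0 k"
  shows "periodic_mod_from d v n0 (period_mod d v)"
proof -
  let ?r = "period_mod d v"
  obtain n1 where n1: "periodic_mod_from d v n1 ?r"
    unfolding period_mod_def using assms LeastI_ex[of "\<lambda>k. \<exists>n0. periodic_mod_from d v n0 k"]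
    by blast
  have k: "k \<ge> 1" using assms by (simp add: periodic_mod_from_def)
  have shift: "[v n = v (n + m * k)] (mod d)" if "n \<ge> n0" for n m
  proof (induction m)
    case (Suc m)
    have "[v (n + m * k) = v (n + m * k + k)] (mod d)"
      using assms that by (simp add: periodic_mod_from_def)
    with Suc show ?case
      by (metis cong_trans add.assoc add.commute mult_Suc)
  qed simp
  have "[v n = v (n + ?r)] (mod d)" if n: "n \<ge> n0" for n
  proof -
    have "n1 \<le> n1 * k" using k by simp
    then have ge: "n + n1 * k \<ge> n1" by linarith
    have a: "[v n = v (n + n1 * k)] (mod d)" using shift n by blast
    have b: "[v (n + n1 * k) = v (n + n1 * k + ?r)] (mod d)"
      using n1 ge by (simp add: periodic_mod_from_def)
    have "[v (n + ?r) = v (n + ?r + n1 * k)] (mod d)" using shift n by simp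
    then have c: "[v (n + n1 * k + ?r) = v (n + ?r)] (mod d)"
      by (simp add: ac_simps cong_sym_eq)
    show ?thesis using a b c cong_trans by blast
  qed
  then show ?thesis
    using assms n1 by (simp add: periodic_mod_from_def)
qed

end

theory Submission
  imports Defs
begin

text \<open>
  Four times the difference \<open>u q (n + k) - u q n\<close> is
  \<open>3 ^ n * (3 ^ k - 1) - qstar q * (- 1) ^ n * ((- 1) ^ k - 1)\<close>. For even \<open>k\<close> the second term
  vanishes, and divisibility by \<open>4 * d\<close> splits into a condition on \<open>n\<close> (at the prime 3) and one
  on \<open>k\<close> (modulo \<open>4 * \<delta>\<close>). For odd \<open>k\<close>, eliminating the power of 3 between two consecutive
  indices shows \<open>d dvd 2 * q\<close>, and a computation modulo 8 excludes even \<open>d\<close>; so \<open>d = q\<close>, and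
  \<open>k\<close> is a period iff \<open>ord q 3\<close> divides \<open>k\<close>.
\<close>

section \<open>Congruences between terms as divisibility by \<open>4 * d\<close>\<close>

lemma four_mult_u:
  assumes "odd q"
  shows "4 * u q j = 3 ^ j - qstar q * (- 1) ^ j"
proof -
  have "real_of_int (4 * u q j) = real_of_int (3 ^ j - qstar q * (- 1) ^ j)"
    using u_exact[OF assms, of j] by simp
  then show ?thesis
    by (simp only: of_int_eq_iff)
qed

lemma four_mult_u_diff:
  assumes "odd q"
  shows "4 * (u q (n + k) - u q n) =
    3 ^ n * (3 ^ k - 1) - qstar q * (- 1) ^ n * ((- 1) ^ k - 1)"
proof -
  have "4 * (u q (n + k) - u q n) = 4 * u q (n + k) - 4 * u q n"
    by simp
  then show ?thesis
    by (simp only: four_mult_u[OF assms] power_add) (simp add: algebra_simps)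
qed

text \<open>Scaling by 4 removes the division hidden in \<open>u\<close>; this is why the modulus
  becomes \<open>4 * d\<close> and orders modulo \<open>4 * \<delta>\<close> appear later.\<close>

lemma cong_u_iff:
  assumes "odd q"
  shows "[u q n = u q (n + k)] (mod d) \<longleftrightarrow>
    4 * d dvd 3 ^ n * (3 ^ k - 1) - qstar q * (- 1) ^ n * ((- 1) ^ k - 1)"
proof -
  have "4 * d dvd 4 * (u q (n + k) - u q n) \<longleftrightarrow> d dvd u q (n + k) - u q n"
    by (simp only: dvd_mult_cancel_left) simp
  then show ?thesis
    by (metis cong_iff_dvd_diff cong_sym_eq four_mult_u_diff[OF assms])
qed

lemma abs_qstar [simp]: "\<bar>qstar q\<bar> = int q"
  by (simp add: qstar_def abs_mult power_abs)

text \<open>If \<open>a\<close> is not a unit modulo \<open>m\<close>, then \<open>ord m a\<close>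
  is 0, which divides only \<open>k = 0\<close>; so coprimality is not assumed.\<close>

lemma dvd_power_minus_one_iff_ord_dvd:
  fixes a m k :: nat
  assumes "a > 0"
  shows "int m dvd int a ^ k - 1 \<longleftrightarrow> ord m a dvd k"
proof -
  have "int m dvd int a ^ k - 1 \<longleftrightarrow> [int (a ^ k) = int 1] (mod int m)"
    by (simp add: cong_iff_dvd_diff)
  then show ?thesis
    by (simp only: cong_int_iff ord_divides)
qed

section \<open>Even periods\<close>

lemma coprime_power_minus_one:
  fixes a :: int
  assumes "k \<ge> 1"
  shows "coprime a (a ^ k - 1)"
proof (rule coprimeI)
  fix c assume c: "c dvd a" "c dvd a ^ k - 1"
  have "c dvd a ^ k"
    using assms c(1) by (intro dvd_trans[OF _ dvd_power]) auto
  then have "c dvd a ^ k - (a ^ k - 1)"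
    using c(2) by (rule dvd_diff)
  then show "is_unit c"
    by simp
qed

text \<open>The conditions on start and period decouple: \<open>3 ^ \<alpha>\<close> is coprime to
  \<open>3 ^ (2 * m) - 1\<close>, hence must divide \<open>3 ^ n\<close>, while
  \<open>4 * \<delta>\<close> is coprime to \<open>3 ^ n\<close>, hence must divide
  \<open>9 ^ m - 1\<close>.\<close>

lemma periodic_from_even_iff:
  fixes q \<alpha> \<delta> :: nat
  assumes "odd q" and "coprime \<delta> 3"
  shows "periodic_mod_from (int (3 ^ \<alpha> * \<delta>)) (u q) n0 (2 * m) \<longleftrightarrow>
    n0 \<ge> max 1 \<alpha> \<and> m \<ge> 1 \<and> ord (4 * \<delta>) 9 dvd m"
proof (cases "m \<ge> 1")
  case True
  \<comment> \<open>For \<open>m = 0\<close> the right-hand side is 0 and this can fail, hence the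
    case split.\<close>
  have cop3: "coprime (3 ^ \<alpha> :: int) (3 ^ (2 * m) - 1)"
    using True coprime_power_minus_one[of "2 * m" 3] by simp
  have "coprime (int \<delta>) (int 3)"
    using assms(2) by (simp only: coprime_int_iff)
  moreover have "coprime (4::int) 3"
    using coprime_add_one_left[of "3::int"] by simp
  ultimately have cop\<delta>: "coprime (4 * int \<delta>) 3"
    by simp
  have "[u q n = u q (n + 2 * m)] (mod int (3 ^ \<alpha> * \<delta>)) \<longleftrightarrow> \<alpha> \<le> n \<and> ord (4 * \<delta>) 9 dvd m" for n
  proof -
    have "[u q n = u q (n + 2 * m)] (mod int (3 ^ \<alpha> * \<delta>)) \<longleftrightarrow>
        3 ^ \<alpha> * (4 * int \<delta>) dvd 3 ^ n * (3 ^ (2 * m) - 1)"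
      by (simp add: cong_u_iff[OF assms(1)] ac_simps)
    also have "\<dots> \<longleftrightarrow> 3 ^ \<alpha> dvd 3 ^ n * (3 ^ (2 * m) - 1 :: int) \<and>
        4 * int \<delta> dvd 3 ^ n * (3 ^ (2 * m) - 1)"
    proof -
      have "coprime (3 ^ \<alpha>) (4 * int \<delta>)"
        using cop\<delta> by (metis coprime_commute coprime_power_right_iff)
      then show ?thesis
        by (meson divides_mult dvd_mult_left dvd_mult_right)
    qed
    also have "\<dots> \<longleftrightarrow> (3 ^ \<alpha> :: int) dvd 3 ^ n \<and> 4 * int \<delta> dvd 3 ^ (2 * m) - 1"
      using cop3 cop\<delta> by (simp only: coprime_dvd_mult_left_iff coprime_dvd_mult_right_iff
          coprime_power_right_iff simp_thms)
    also have "4 * int \<delta> dvd 3 ^ (2 * m) - 1 \<longleftrightarrow> ord (4 * \<delta>) 9 dvd m"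
      using dvd_power_minus_one_iff_ord_dvd[of 9 "4 * \<delta>" m] by (simp add: power_mult)
    also have "(3 ^ \<alpha> :: int) dvd 3 ^ n \<longleftrightarrow> \<alpha> \<le> n"
      by (simp add: dvd_power_iff)
    finally show ?thesis .
  qed
  then have "periodic_mod_from (int (3 ^ \<alpha> * \<delta>)) (u q) n0 (2 * m) \<longleftrightarrow>
      n0 \<ge> 1 \<and> 2 * m \<ge> 1 \<and> (\<forall>n\<ge>n0. \<alpha> \<le> n \<and> ord (4 * \<delta>) 9 dvd m)"
    by (simp only: periodic_mod_from_def)
  then show ?thesis
    using True by auto
qed (simp add: periodic_mod_from_def)

lemma periodic_from_double:
  assumes "periodic_mod_from d v n0 k"
  shows "periodic_mod_from d v n0 (2 * k)"
  unfolding periodic_mod_from_def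
proof (intro conjI allI impI)
  fix n assume "n0 \<le> n"
  then have "[v n = v (n + k)] (mod d)" "[v (n + k) = v (n + k + k)] (mod d)"
    using assms by (auto simp: periodic_mod_from_def)
  then show "[v n = v (n + 2 * k)] (mod d)"
    by (metis cong_trans add.assoc mult_2)
qed (use assms in \<open>auto simp: periodic_mod_from_def\<close>)

section \<open>Odd periods\<close>

lemma odd_period_imp_eq:
  fixes q d :: nat
  assumes "prime q" "odd q" "d > 1" "odd k"
    and "periodic_mod_from (int d) (u q) n0 k"
  shows "d = q"
proof -
  define s where "s = qstar q * (- 1) ^ n0"
  have s: "\<bar>s\<bar> = int q"
    by (simp add: s_def abs_mult power_abs)
  \<comment> \<open>For odd \<open>k\<close> the last factor is -2, and moving to the next index
    flips the sign of \<open>s\<close>.\<close>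
  have e1: "3 ^ n0 * (3 ^ k - 1) - qstar q * (- 1) ^ n0 * ((- 1) ^ k - 1) =
      3 ^ n0 * (3 ^ k - 1) + 2 * s"
    and e2: "3 ^ Suc n0 * (3 ^ k - 1) - qstar q * (- 1) ^ Suc n0 * ((- 1) ^ k - 1) =
      3 * (3 ^ n0 * (3 ^ k - 1)) - 2 * s"
    using \<open>odd k\<close> by (simp_all add: s_def)
  have "4 * int d dvd 3 ^ n0 * (3 ^ k - 1) - qstar q * (- 1) ^ n0 * ((- 1) ^ k - 1)"
    "4 * int d dvd 3 ^ Suc n0 * (3 ^ k - 1) - qstar q * (- 1) ^ Suc n0 * ((- 1) ^ k - 1)"
    using assms(5) cong_u_iff[OF assms(2)] by (auto simp: periodic_mod_from_def simp del: power_Suc)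
  then have A: "4 * int d dvd 3 ^ n0 * (3 ^ k - 1) + 2 * s"
    and B: "4 * int d dvd 3 * (3 ^ n0 * (3 ^ k - 1)) - 2 * s"
    unfolding e1 e2 .
  \<comment> \<open>The powers of 3 cancel and \<open>8 * s\<close> remains.\<close>
  have "4 * int d dvd 3 * (3 ^ n0 * (3 ^ k - 1) + 2 * s) - (3 * (3 ^ n0 * (3 ^ k - 1)) - 2 * s)"
    by (rule dvd_diff[OF dvd_mult[OF A] B])
  then have "4 * int d dvd 4 * (2 * s)"
    by (simp add: algebra_simps)
  then have "int d dvd 2 * s"
    by (simp only: dvd_mult_cancel_left) simp
  then have "int d dvd int (2 * q)"
    using s by (metis abs_dvd_iff dvd_abs_iff abs_mult abs_numeral of_nat_mult of_nat_numeral)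
  then have "d dvd 2 * q"
    by (simp only: int_dvd_int_iff)
  moreover have "odd d"
  proof
    assume "even d"
    then have "8 dvd 4 * int d"
      by auto
    with A have "8 dvd 3 ^ n0 * (3 ^ k - 1) + 2 * s"
      by (rule dvd_trans[rotated])
    \<comment> \<open>Since 9 is 1 modulo 8, every odd power of 3 is 3 modulo 8.\<close>
    moreover have "[3 ^ n0 * (3 ^ k - 1) = (3 ^ n0 * 2 :: int)] (mod 8)"
    proof -
      obtain l where l: "k = 2 * l + 1" using \<open>odd k\<close> by (elim oddE)
      have "[(9::int) ^ l = 1 ^ l] (mod 8)"
        by (intro cong_pow) (simp add: cong_def)
      then have "[(3::int) ^ k = 3] (mod 8)"
        using cong_scalar_left[of "9 ^ l" 1 8 3] by (simp add: l power_mult)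
      then have "[(3::int) ^ k - 1 = 3 - 1] (mod 8)"
        by (intro cong_diff) auto
      then show ?thesis
        by (intro cong_scalar_left) simp
    qed
    ultimately have "8 dvd 3 ^ n0 * 2 + 2 * s"
      by (metis cong_add_rcancel cong_dvd_iff)
    then have "(2 * 4) dvd 2 * (3 ^ n0 + s)"
      by (simp add: algebra_simps)
    then have "4 dvd 3 ^ n0 + s"
      by (simp only: dvd_mult_cancel_left) simp
    \<comment> \<open>This difference is \<open>4 * u q n0\<close>. Adding it to the previous sum
      eliminates \<open>s\<close> and would make a power of 3 even.\<close>
    moreover have "4 dvd 3 ^ n0 - s"
      using four_mult_u[OF \<open>odd q\<close>, of n0] by (metis s_def dvd_triv_left)
    ultimately have "4 dvd (3 ^ n0 + s) + (3 ^ n0 - s)"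
      by (rule dvd_add)
    then have "2 * 2 dvd 2 * (3::int) ^ n0"
      by (simp add: algebra_simps)
    then have "even ((3::int) ^ n0)"
      by (simp only: dvd_mult_cancel_left) simp
    then show False
      by simp
  qed
  ultimately have "d dvd q"
    by (metis coprime_dvd_mult_right_iff coprime_right_2_iff_odd)
  then show ?thesis
    using assms by (auto simp: prime_nat_iff)
qed

text \<open>Modulo \<open>q\<close> the term with \<open>qstar q\<close> vanishes and
  \<open>3 ^ n\<close> is a unit, so the condition does not depend on \<open>n\<close>.\<close>

lemma periodic_from_odd_iff:
  fixes q :: nat
  assumes "prime q" "q \<ge> 5" "odd k"
  shows "periodic_mod_from (int q) (u q) n0 k \<longleftrightarrow> n0 \<ge> 1 \<and> ord q 3 dvd k"
proof -
  have "odd q"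
    using assms by (intro prime_odd_nat) auto
  have cop3: "coprime (int q) (3 ^ n)" for n
  proof -
    have "coprime q 3"
      using assms by (intro primes_coprime) auto
    then have "coprime (int q) (int 3)"
      by (simp only: coprime_int_iff)
    then show ?thesis
      by simp
  qed
  have "[u q n = u q (n + k)] (mod int q) \<longleftrightarrow> ord q 3 dvd k" for n
  proof -
    have "coprime (4::int) (int q)"
      using \<open>odd q\<close> coprime_power_left_iff[of "2::int" 2 "int q"] by simp
    define E where "E = 3 ^ n * (3 ^ k - 1) - qstar q * (- 1) ^ n * ((- 1) ^ k - 1)"
    \<comment> \<open>\<open>E\<close> is 4 times a difference of terms, so only divisibility by
      \<open>q\<close> is left to decide.\<close>
    have "4 dvd E"
      unfolding E_def four_mult_u_diff[OF \<open>odd q\<close>, symmetric] by simp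
    have "[u q n = u q (n + k)] (mod int q) \<longleftrightarrow> 4 * int q dvd E"
      by (simp only: cong_u_iff[OF \<open>odd q\<close>] E_def)
    also have "\<dots> \<longleftrightarrow> int q dvd E"
      using \<open>4 dvd E\<close> \<open>coprime 4 (int q)\<close> by (meson divides_mult dvd_mult_right)
    also have "\<dots> \<longleftrightarrow> int q dvd 3 ^ n * (3 ^ k - 1)"
    proof -
      have "int q dvd qstar q * (- 1) ^ n * ((- 1) ^ k - 1)"
        by (simp add: qstar_def)
      then show ?thesis
        unfolding E_def by (metis diff_add_cancel dvd_add_left_iff)
    qed
    also have "\<dots> \<longleftrightarrow> int q dvd 3 ^ k - 1"
      using cop3 by (simp only: coprime_dvd_mult_right_iff)
    also have "\<dots> \<longleftrightarrow> ord q 3 dvd k"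
      using dvd_power_minus_one_iff_ord_dvd[of 3 q k] by simp
    finally show ?thesis .
  qed
  then show ?thesis
    using odd_pos[OF \<open>odd k\<close>] by (auto simp: periodic_mod_from_def)
qed

text \<open>As 4 always divides \<open>9 ^ m - 1\<close>, the order of 9 modulo \<open>4 * q\<close>
  divides \<open>m\<close> iff \<open>ord q 3\<close> divides \<open>2 * m\<close>, and an odd order
  lets the 2 be dropped. This matches the odd-period criterion with the order in the
  formula.\<close>

lemma ord_9_eq_ord_3:
  fixes q :: nat
  assumes "odd q" "odd (ord q 3)"
  shows "ord (4 * q) 9 = ord q 3"
proof -
  have "ord (4 * q) 9 dvd m \<longleftrightarrow> ord q 3 dvd m" for m
  proof -
    have "coprime (4::int) (int q)"
      using \<open>odd q\<close> coprime_power_left_iff[of "2::int" 2 "int q"] by simp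
    moreover have "[(9::int) ^ m = 1 ^ m] (mod 4)"
      by (intro cong_pow) (simp add: cong_def)
    then have "4 dvd (9::int) ^ m - 1"
      by (simp add: cong_iff_dvd_diff)
    ultimately have "4 * int q dvd 9 ^ m - 1 \<longleftrightarrow> int q dvd 3 ^ (2 * m) - 1"
      by (simp add: power_mult) (meson divides_mult dvd_mult_right)
    then have "ord (4 * q) 9 dvd m \<longleftrightarrow> ord q 3 dvd 2 * m"
      using dvd_power_minus_one_iff_ord_dvd[of 9 "4 * q" m]
        dvd_power_minus_one_iff_ord_dvd[of 3 q "2 * m"] by simp
    then show ?thesis
      using assms(2) by (metis coprime_dvd_mult_right_iff coprime_right_2_iff_odd)
  qed
  then show ?thesis
    by (metis dvd_antisym dvd_refl)
qed

theorem theorem3: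
  fixes q d \<alpha> \<delta> :: nat
  assumes "prime q" and "q \<ge> 5"
    and "d > 1" and "d = 3 ^ \<alpha> * \<delta>" and "coprime \<delta> 3"
  shows "eventually_periodic_mod (int d) (u q)
    \<and> period_mod (int d) (u q) =
        (if d = q \<and> odd (ord q 3) then ord (4 * \<delta>) 9 else 2 * ord (4 * \<delta>) 9)
    \<and> preperiod_mod (int d) (u q) = max 1 \<alpha>"
proof -
  let ?P = "periodic_mod_from (int d) (u q)" and ?r = "ord (4 * \<delta>) 9"
  have "odd q"
    using assms(1,2) by (intro prime_odd_nat) auto
  have even_iff: "?P n (2 * m) \<longleftrightarrow> n \<ge> max 1 \<alpha> \<and> m \<ge> 1 \<and> ?r dvd m" for n m
    using periodic_from_even_iff[OF \<open>odd q\<close> assms(5)] assms(4) by simp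
  have "coprime (4 * \<delta>) 3"
    using assms(5) coprime_add_one_left[of "3::nat"] by simp
  then have "coprime (4 * \<delta>) (3 ^ 2)"
    by (simp only: coprime_power_right_iff simp_thms)
  then have "coprime (4 * \<delta>) 9"
    by (simp only: power2_eq_square) simp
  \<comment> \<open>\<open>ord\<close> takes the value 0 exactly in the non-coprime case.\<close>
  then have "?r \<noteq> 0"
    by (simp only: ord_eq_0) simp
  then have "?r \<ge> 1"
    by linarith
  have P: "?P (max 1 \<alpha>) (2 * ?r)"
    using \<open>?r \<ge> 1\<close> by (simp add: even_iff del: max.bounded_iff)
  then have "eventually_periodic_mod (int d) (u q)"
    unfolding eventually_periodic_mod_def by blast
  moreover have "preperiod_mod (int d) (u q) = max 1 \<alpha>"
    unfolding preperiod_mod_def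
  proof (rule Least_equality)
    show "\<exists>k. ?P (max 1 \<alpha>) k"
      using P by blast
    \<comment> \<open>Doubling an arbitrary period keeps its start index and makes
      \<open>even_iff\<close> applicable.\<close>
    show "max 1 \<alpha> \<le> n" if "\<exists>k. ?P n k" for n
      using that periodic_from_double even_iff by blast
  qed
  moreover have "period_mod (int d) (u q) = (if d = q \<and> odd (ord q 3) then ?r else 2 * ?r)"
  proof (cases "d = q \<and> odd (ord q 3)")
    case True
    \<comment> \<open>With \<open>d = q\<close> this gives \<open>\<alpha> = 0\<close> and
      \<open>\<delta> = q\<close>.\<close>
    have "\<not> 3 dvd q"
      using assms(1,2) by (auto simp: prime_nat_iff)
    then have "\<alpha> = 0"
      using True assms(4) by (cases \<alpha>) (auto simp: mult.assoc)
    then have r: "?r = ord q 3"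
      using True assms(4) ord_9_eq_ord_3[OF \<open>odd q\<close>] by simp
    show ?thesis
      unfolding period_mod_def if_P[OF True]
    proof (rule Least_equality)
      have "?P 1 ?r"
        using True periodic_from_odd_iff[OF assms(1,2), of ?r 1] r by simp
      then show "\<exists>n. ?P n ?r" ..
      show "?r \<le> k" if ex: "\<exists>n. ?P n k" for k
      proof -
        obtain n where n: "?P n k"
          using ex by blast
        \<comment> \<open>\<open>even_iff\<close> applied to the doubled period yields that
          \<open>?r\<close> divides \<open>k\<close> itself.\<close>
        then have "?P n (2 * k)"
          by (rule periodic_from_double)
        then show ?thesis
          by (auto simp: even_iff dest: dvd_imp_le)
      qed
    qed
  next
    case False
    show ?thesis
      unfolding period_mod_def if_not_P[OF False]
    proof (rule Least_equality)
      show "\<exists>n. ?P n (2 * ?r)"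
        using P by blast
      show "2 * ?r \<le> k" if ex: "\<exists>n. ?P n k" for k
      proof -
        obtain n where n: "?P n k"
          using ex by blast
        \<comment> \<open>An odd period would force \<open>d = q\<close> and make
          \<open>ord q 3\<close> a divisor of an odd number, which is the excluded case.\<close>
        have "even k"
        proof (rule ccontr)
          assume "odd k"
          then have "d = q"
            using odd_period_imp_eq[OF assms(1) \<open>odd q\<close> assms(3)] n by blast
          then have "ord q 3 dvd k"
            using n periodic_from_odd_iff[OF assms(1,2) \<open>odd k\<close>] by simp
          then show False
            using False \<open>d = q\<close> \<open>odd k\<close> by auto
        qed
        then obtain m where "k = 2 * m" by (elim evenE)
        then show ?thesis
          using n by (auto simp: even_iff dest: dvd_imp_le)
      qed
    qed
  qed
  ultimately show ?thesis
    by blast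
qed

end
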